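(* Let $X,Y\in L^1$ be non-degenerate real random variables whose distributions have no atoms and whose supports are intervals, so that their cdfs $F_X$ and $F_Y$ are strictly increasing and continuous on their supports. Then $F_X\leq_{we-disp}F_Y$ if and only if $F_X\leq_{dil}F_Y$.
   Context: $L^1$ denotes the set of random variables with finite mean; $F_X$ is the cumulative distribution function (cdf) of $X$. Expectiles: for $\alpha\in(0,1)$ and $X\in L^1$, the $\alpha$-expectile $e_X(\alpha)$ is the unique minimizer over $t\in\mathbb{R}$ of $E[\ell_\alpha(X-t)-\ell_\alpha(X)]$, where $\ell_\alpha(x)=\alpha x^2$ for $x\ge 0$ and $\ell_\alpha(x)=(1-\alpha)x^2$ for $x<0$. Equivalently, $e_X(\alpha)$ is the unique $t\in\mathbb{R}$ solving $\alpha E(X-t)_+=(1-\alpha)E(X-t)_-$, where $x_+=\max\{x,0\}$ and $x_-=\max\{-x,0\}$. Weak expectile dispersive order: $F_X\leq_{we-disp}F_Y$ means $$e_X(v)-e_X(u)\leq e_Y(v)-e_Y(u)\quad\text{for all } u,v \text{ with } 0<u\leq 1/2\leq v<1.$$ Convex order: $X\leq_{cx}Y$ means $E\phi(X)\leq E\phi(Y)$ for all convex functions $\phi:\mathbb{R}\to\mathbb{R}$ for which both expectations exist. Dilation order: $F_X\leq_{dil}F_Y$ means $X-EX\leq_{cx}Y-EY$. *)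

theory Defs
  imports "HOL-Probability.Probability"
begin

definition expectile_loss :: "real \<Rightarrow> real \<Rightarrow> real" where
  "expectile_loss \<alpha> x = (if x \<ge> 0 then \<alpha> * x\<^sup>2 else (1 - \<alpha>) * x\<^sup>2)"

text \<open>Subtracting the loss of \<open>X\<close> itself makes the integrand integrable for every
  integrable \<open>X\<close>, without a second moment.\<close>

definition expectile_risk :: "'a measure \<Rightarrow> ('a \<Rightarrow> real) \<Rightarrow> real \<Rightarrow> real \<Rightarrow> real" where
  "expectile_risk M X \<alpha> t =
     (\<integral>\<omega>. (expectile_loss \<alpha> (X \<omega> - t) - expectile_loss \<alpha> (X \<omega>)) \<partial>M)"

text \<open>The minimizer exists and is unique when \<open>0 < \<alpha> < 1\<close>, \<open>M\<close> is a probability space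
  and \<open>X\<close> is integrable; the value is unspecified otherwise.\<close>

definition expectile :: "'a measure \<Rightarrow> ('a \<Rightarrow> real) \<Rightarrow> real \<Rightarrow> real" where
  "expectile M X \<alpha> = (THE t. is_arg_min (expectile_risk M X \<alpha>) (\<lambda>_. True) t)"

text \<open>The orders compare laws, so the two random variables may live on different
  probability spaces.\<close>

definition weak_expectile_disp_le ::
    "'a measure \<Rightarrow> ('a \<Rightarrow> real) \<Rightarrow> 'b measure \<Rightarrow> ('b \<Rightarrow> real) \<Rightarrow> bool" where
  "weak_expectile_disp_le M X N Y \<longleftrightarrow>
     (\<forall>u v. 0 < u \<and> u \<le> 1/2 \<and> 1/2 \<le> v \<and> v < 1 \<longrightarrow>
        expectile M X v - expectile M X u \<le> expectile N Y v - expectile N Y u)"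

text \<open>Existence of an expectation is rendered as integrability, since the Bochner integral
  of a non-integrable function is 0 by convention.\<close>

definition convex_order_le ::
    "'a measure \<Rightarrow> ('a \<Rightarrow> real) \<Rightarrow> 'b measure \<Rightarrow> ('b \<Rightarrow> real) \<Rightarrow> bool" where
  "convex_order_le M X N Y \<longleftrightarrow>
     (\<forall>\<phi> :: real \<Rightarrow> real. convex_on UNIV \<phi> \<longrightarrow>
        integrable M (\<lambda>\<omega>. \<phi> (X \<omega>)) \<longrightarrow> integrable N (\<lambda>\<omega>. \<phi> (Y \<omega>)) \<longrightarrow>
        (\<integral>\<omega>. \<phi> (X \<omega>) \<partial>M) \<le> (\<integral>\<omega>. \<phi> (Y \<omega>) \<partial>N))"

definition dilation_le ::
    "'a measure \<Rightarrow> ('a \<Rightarrow> real) \<Rightarrow> 'b measure \<Rightarrow> ('b \<Rightarrow> real) \<Rightarrow> bool" where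
  "dilation_le M X N Y \<longleftrightarrow>
     convex_order_le M (\<lambda>\<omega>. X \<omega> - integral\<^sup>L M X) N (\<lambda>\<omega>. Y \<omega> - integral\<^sup>L N Y)"

definition degenerate :: "'a measure \<Rightarrow> ('a \<Rightarrow> real) \<Rightarrow> bool" where
  "degenerate M X \<longleftrightarrow> (\<exists>c. AE \<omega> in M. X \<omega> = c)"

definition measure_support :: "real measure \<Rightarrow> real set" where
  "measure_support \<mu> = {x. \<forall>U. open U \<longrightarrow> x \<in> U \<longrightarrow> measure \<mu> U > 0}"

definition atomless :: "real measure \<Rightarrow> bool" where
  "atomless \<mu> \<longleftrightarrow> (\<forall>x. measure \<mu> {x} = 0)"

end

theory Submission
  imports Defs
begin

text \<open>
  Both orders say the same thing about the stop-loss transforms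
  \<open>\<pi>\<^sub>X(t) = E (X - t)\<^sub>+\<close> of the centred variables, namely that
  \<open>\<pi>\<^sub>X(EX + d) \<le> \<pi>\<^sub>Y(EY + d)\<close> for every real \<open>d\<close>.

  For the dilation order this is the classical description of the convex order between
  variables of equal mean (\<open>convex_order_le_iff_stop_loss\<close>). The stop-loss functions
  \<open>x \<mapsto> (x - t)\<^sub>+\<close> are convex. Conversely, a convex \<open>\<phi>\<close> is the increasing limit of maxima of
  finitely many of its tangents, and such a maximum is an affine function plus a nonnegative
  combination of stop-loss functions: when the tangents are added from left to right, each new
  one contributes a single such function (\<open>Max_tangents_insert\<close>).

  For expectiles the link is the first-order condition. The risk minimised by the
  \<open>\<alpha>\<close>-expectile is strictly convex, and its derivative vanishes at \<open>t\<close> exactly when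
  \<open>(1 - \<alpha>) (t - EX) = (2 \<alpha> - 1) \<pi>\<^sub>X(t)\<close>. Hence the inequality between these two sides tells
  on which side of the expectile a given \<open>t\<close> lies (\<open>expectile_compare\<close>). Since the
  \<open>1/2\<close>-expectile is the mean, the weak expectile dispersive order means that for
  \<open>v \<ge> 1/2\<close> the expectiles of \<open>Y\<close> are at least as far above the mean as those of \<open>X\<close>, and
  for \<open>u \<le> 1/2\<close> at least as far below it. A larger stop-loss transform pushes the expectiles
  in just this way. Conversely, each deviation \<open>d \<noteq> 0\<close> at which
  \<open>\<pi>\<^sub>X(EX + d)\<close> exceeds its trivial lower bound \<open>max 0 (- d)\<close> is the deviation of some expectile of
  \<open>X\<close>, and comparing that expectile with the one of \<open>Y\<close> compares the transforms at \<open>d\<close>; the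
  remaining value \<open>d = 0\<close> follows by continuity (\<open>weak_expectile_disp_le_iff_stop_loss\<close>).
\<close>

section \<open>Stop-loss transforms\<close>

definition stop_loss :: "'a measure \<Rightarrow> ('a \<Rightarrow> real) \<Rightarrow> real \<Rightarrow> real" where
  "stop_loss M X t = (\<integral>\<omega>. max 0 (X \<omega> - t) \<partial>M)"

context prob_space
begin

lemma integrable_stop_loss:
  fixes X :: "'a \<Rightarrow> real"
  assumes "integrable M X"
  shows "integrable M (\<lambda>\<omega>. max 0 (X \<omega> - t))"
  using assms by simp

lemma stop_loss_nonneg: "stop_loss M X t \<ge> 0"
  unfolding stop_loss_def by (rule integral_nonneg_AE) auto

lemma stop_loss_ge_mean:
  assumes "integrable M X"
  shows "expectation X - t \<le> stop_loss M X t"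
proof -
  have "expectation X - t = expectation (\<lambda>\<omega>. X \<omega> - t)"
    using assms by (simp add: prob_space)
  also have "\<dots> \<le> stop_loss M X t"
    unfolding stop_loss_def using assms
    by (intro integral_mono integrable_stop_loss) auto
  finally show ?thesis .
qed

lemma stop_loss_antimono:
  assumes "integrable M X" "s \<le> t"
  shows "stop_loss M X t \<le> stop_loss M X s"
  unfolding stop_loss_def using assms
  by (intro integral_mono integrable_stop_loss) auto

lemma stop_loss_Lipschitz:
  assumes "integrable M X" "s \<le> t"
  shows "stop_loss M X s \<le> stop_loss M X t + (t - s)"
proof -
  have "stop_loss M X s \<le> expectation (\<lambda>\<omega>. max 0 (X \<omega> - t) + (t - s))"
    unfolding stop_loss_def using assms
    by (intro integral_mono integrable_stop_loss Bochner_Integration.integrable_add) auto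
  also have "\<dots> = stop_loss M X t + (t - s)"
    unfolding stop_loss_def using integrable_stop_loss[OF assms(1)] by (simp add: prob_space)
  finally show ?thesis .
qed

end

section \<open>Expectiles through the stop-loss transform\<close>

text \<open>Half the derivative of the expectile loss: \<open>\<alpha> x\<close> for \<open>x \<ge> 0\<close> and \<open>(1 - \<alpha>) x\<close> for
  \<open>x < 0\<close>. Written with the positive part so that its expectation is visibly affine in the
  stop-loss transform.\<close>

definition expectile_score :: "real \<Rightarrow> real \<Rightarrow> real" where
  "expectile_score \<alpha> x = (2 * \<alpha> - 1) * max 0 x + (1 - \<alpha>) * x"

text \<open>Strong convexity of the loss. Its quadratic term makes the zero of the expected score the
  unique minimiser of the risk, and its linear term shows that differences of losses grow
  only linearly, so that a first moment suffices for their integrability.\<close>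

lemma expectile_loss_above_tangent:
  fixes x y :: real
  assumes "0 < \<alpha>" "\<alpha> < 1"
  shows "expectile_loss \<alpha> x + 2 * expectile_score \<alpha> x * (y - x)
           + min \<alpha> (1 - \<alpha>) * (y - x)\<^sup>2 \<le> expectile_loss \<alpha> y"
proof -
  define c where "c = min \<alpha> (1 - \<alpha>)"
  have c: "0 < c" "c \<le> \<alpha>" "c \<le> 1 - \<alpha>" using assms by (auto simp: c_def)
  have sq: "c * z\<^sup>2 \<le> \<alpha> * z\<^sup>2" "c * z\<^sup>2 \<le> (1 - \<alpha>) * z\<^sup>2" for z
    using c by (auto intro: mult_right_mono)
  \<comment> \<open>when \<open>x\<close> and \<open>y\<close> lie on different sides of 0, the cross term has a favourable sign\<close>
  have mixed: "c * (y - x)\<^sup>2 \<le> a * x\<^sup>2 + b * y\<^sup>2 - 2 * a * x * y"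
    if "c \<le> a" "c \<le> b" "x * y \<le> 0" for a b
  proof -
    have "c * x\<^sup>2 \<le> a * x\<^sup>2" "c * y\<^sup>2 \<le> b * y\<^sup>2" "a * (x * y) \<le> c * (x * y)"
      using that by (auto intro: mult_right_mono mult_right_mono_neg)
    then show ?thesis by (simp add: power2_eq_square algebra_simps)
  qed
  consider "x \<ge> 0" "y \<ge> 0" | "x < 0" "y < 0" | "x \<ge> 0" "y < 0" | "x < 0" "y \<ge> 0" by linarith
  then show ?thesis
  proof cases
    case 1
    then show ?thesis using sq(1)[of "y - x"]
      by (simp add: expectile_loss_def expectile_score_def c_def power2_eq_square algebra_simps)
  next
    case 2
    then show ?thesis using sq(2)[of "y - x"]
      by (simp add: expectile_loss_def expectile_score_def c_def power2_eq_square algebra_simps)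
  next
    case 3
    then have "x * y \<le> 0" by (simp add: mult_nonneg_nonpos)
    with 3 show ?thesis using mixed[of "\<alpha>" "1 - \<alpha>"] c
      by (simp add: expectile_loss_def expectile_score_def c_def power2_eq_square algebra_simps)
  next
    case 4
    then have "x * y \<le> 0" by (simp add: mult_nonpos_nonneg)
    with 4 show ?thesis using mixed[of "1 - \<alpha>" "\<alpha>"] c
      by (simp add: expectile_loss_def expectile_score_def c_def power2_eq_square algebra_simps)
  qed
qed

lemma expectile_score_increment:
  fixes x y :: real
  assumes "0 < \<alpha>" "\<alpha> < 1" "x \<le> y"
  shows "min \<alpha> (1 - \<alpha>) * (y - x) \<le> expectile_score \<alpha> y - expectile_score \<alpha> x"
proof -
  define c where "c = min \<alpha> (1 - \<alpha>)"
  have c: "c \<le> \<alpha>" "c \<le> 1 - \<alpha>" by (auto simp: c_def)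
  have *: "0 \<le> (\<alpha> - c) * (max 0 y - max 0 x)" "0 \<le> (1 - \<alpha> - c) * (min 0 y - min 0 x)"
    using c assms by auto
  have sp: "expectile_score \<alpha> z = \<alpha> * max 0 z + (1 - \<alpha>) * min 0 z" for z
    by (auto simp: expectile_score_def max_def min_def algebra_simps)
  have z: "z = max 0 z + min 0 z" for z :: real by auto
  have "c * (y - x) = c * (max 0 y - max 0 x) + c * (min 0 y - min 0 x)"
    by (subst z[of y], subst z[of x]) (simp add: algebra_simps)
  also have "\<dots> \<le> expectile_score \<alpha> y - expectile_score \<alpha> x"
    using * unfolding sp by (simp add: algebra_simps)
  finally show ?thesis by (simp add: c_def)
qed

lemma abs_expectile_score_le:
  assumes "0 < \<alpha>" "\<alpha> < 1"
  shows "\<bar>expectile_score \<alpha> x\<bar> \<le> \<bar>x\<bar>"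
proof (cases "x \<ge> 0")
  case True
  then have "expectile_score \<alpha> x = \<alpha> * x" by (simp add: expectile_score_def algebra_simps)
  then show ?thesis using assms by (simp add: abs_mult mult_left_le_one_le)
next
  case False
  then have "expectile_score \<alpha> x = (1 - \<alpha>) * x" by (simp add: expectile_score_def algebra_simps)
  then show ?thesis using assms by (simp add: abs_mult mult_left_le_one_le)
qed

context prob_space
begin

lemma expectation_score:
  assumes "integrable M X"
  shows "integrable M (\<lambda>\<omega>. expectile_score \<alpha> (X \<omega> - t))"
    and "expectation (\<lambda>\<omega>. expectile_score \<alpha> (X \<omega> - t))
           = (2 * \<alpha> - 1) * stop_loss M X t + (1 - \<alpha>) * (expectation X - t)"
  using assms integrable_stop_loss[OF assms]
  unfolding expectile_score_def stop_loss_def by (simp_all add: prob_space)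

text \<open>The tangents of the loss at \<open>X\<close> and at \<open>X - t\<close> bound the difference from below and from
  above by linear functions of \<open>\<bar>X\<bar>\<close>.\<close>

lemma integrable_expectile_loss_diff:
  assumes "integrable M X" "0 < \<alpha>" "\<alpha> < 1"
  shows "integrable M (\<lambda>\<omega>. expectile_loss \<alpha> (X \<omega> - t) - expectile_loss \<alpha> (X \<omega>))"
proof (rule Bochner_Integration.integrable_bound)
  show "integrable M (\<lambda>\<omega>. 2 * \<bar>t\<bar> * (\<bar>X \<omega>\<bar> + \<bar>t\<bar>))"
    using assms(1) by simp
  show "(\<lambda>\<omega>. expectile_loss \<alpha> (X \<omega> - t) - expectile_loss \<alpha> (X \<omega>)) \<in> borel_measurable M"
    using borel_measurable_integrable[OF assms(1)] unfolding expectile_loss_def by measurable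
  show "AE \<omega> in M. norm (expectile_loss \<alpha> (X \<omega> - t) - expectile_loss \<alpha> (X \<omega>))
          \<le> norm (2 * \<bar>t\<bar> * (\<bar>X \<omega>\<bar> + \<bar>t\<bar>))"
  proof (rule AE_I2)
    fix \<omega>
    define x where "x = X \<omega>"
    have c: "0 \<le> min \<alpha> (1 - \<alpha>) * t\<^sup>2" using assms by auto
    have s: "\<bar>2 * expectile_score \<alpha> z * t\<bar> \<le> 2 * \<bar>t\<bar> * (\<bar>x\<bar> + \<bar>t\<bar>)" if "\<bar>z\<bar> \<le> \<bar>x\<bar> + \<bar>t\<bar>" for z
      using mult_left_mono[OF order_trans[OF abs_expectile_score_le[OF assms(2,3), of z] that], of "2 * \<bar>t\<bar>"]
      by (simp add: abs_mult mult_ac)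
    have "expectile_loss \<alpha> x - 2 * expectile_score \<alpha> x * t \<le> expectile_loss \<alpha> (x - t)"
      using expectile_loss_above_tangent[OF assms(2,3), of x "x - t"] c by simp
    moreover have "expectile_loss \<alpha> (x - t) + 2 * expectile_score \<alpha> (x - t) * t \<le> expectile_loss \<alpha> x"
      using expectile_loss_above_tangent[OF assms(2,3), of "x - t" x] c by simp
    moreover have "\<bar>2 * expectile_score \<alpha> x * t\<bar> \<le> 2 * \<bar>t\<bar> * (\<bar>x\<bar> + \<bar>t\<bar>)"
      "\<bar>2 * expectile_score \<alpha> (x - t) * t\<bar> \<le> 2 * \<bar>t\<bar> * (\<bar>x\<bar> + \<bar>t\<bar>)"
      by (intro s; simp)+
    ultimately have "\<bar>expectile_loss \<alpha> (x - t) - expectile_loss \<alpha> x\<bar> \<le> 2 * \<bar>t\<bar> * (\<bar>x\<bar> + \<bar>t\<bar>)"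
      by linarith
    then show "norm (expectile_loss \<alpha> (X \<omega> - t) - expectile_loss \<alpha> (X \<omega>))
          \<le> norm (2 * \<bar>t\<bar> * (\<bar>X \<omega>\<bar> + \<bar>t\<bar>))"
      unfolding x_def by simp
  qed
qed

lemma expectile_risk_above_parabola:
  assumes "integrable M X" "0 < \<alpha>" "\<alpha> < 1"
  shows "expectile_risk M X \<alpha> t + 2 * expectation (\<lambda>\<omega>. expectile_score \<alpha> (X \<omega> - t)) * (t - s)
           + min \<alpha> (1 - \<alpha>) * (t - s)\<^sup>2 \<le> expectile_risk M X \<alpha> s"
proof -
  note int = integrable_expectile_loss_diff[OF assms] expectation_score(1)[OF assms(1), of \<alpha> t]
  have "expectile_risk M X \<alpha> t + 2 * expectation (\<lambda>\<omega>. expectile_score \<alpha> (X \<omega> - t)) * (t - s)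
           + min \<alpha> (1 - \<alpha>) * (t - s)\<^sup>2
      = expectation (\<lambda>\<omega>. (expectile_loss \<alpha> (X \<omega> - t) - expectile_loss \<alpha> (X \<omega>))
          + expectile_score \<alpha> (X \<omega> - t) * (2 * (t - s)) + min \<alpha> (1 - \<alpha>) * (t - s)\<^sup>2)"
    unfolding expectile_risk_def using int by (simp add: prob_space)
  also have "\<dots> \<le> expectile_risk M X \<alpha> s"
    unfolding expectile_risk_def
  proof (rule integral_mono)
    fix \<omega>
    show "expectile_loss \<alpha> (X \<omega> - t) - expectile_loss \<alpha> (X \<omega>)
          + expectile_score \<alpha> (X \<omega> - t) * (2 * (t - s)) + min \<alpha> (1 - \<alpha>) * (t - s)\<^sup>2
        \<le> expectile_loss \<alpha> (X \<omega> - s) - expectile_loss \<alpha> (X \<omega>)"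
      using expectile_loss_above_tangent[OF assms(2,3), of "X \<omega> - t" "X \<omega> - s"]
      by (simp add: algebra_simps)
  qed (use int in \<open>auto intro!: Bochner_Integration.integrable_add\<close>)
  finally show ?thesis .
qed

lemma expectation_score_decrease:
  assumes "integrable M X" "0 < \<alpha>" "\<alpha> < 1" "s \<le> t"
  shows "expectation (\<lambda>\<omega>. expectile_score \<alpha> (X \<omega> - t)) + min \<alpha> (1 - \<alpha>) * (t - s)
           \<le> expectation (\<lambda>\<omega>. expectile_score \<alpha> (X \<omega> - s))"
proof -
  note int = expectation_score(1)[OF assms(1)]
  have "expectation (\<lambda>\<omega>. expectile_score \<alpha> (X \<omega> - t)) + min \<alpha> (1 - \<alpha>) * (t - s)
      = expectation (\<lambda>\<omega>. expectile_score \<alpha> (X \<omega> - t) + min \<alpha> (1 - \<alpha>) * (t - s))"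
    using int by (simp add: prob_space)
  also have "\<dots> \<le> expectation (\<lambda>\<omega>. expectile_score \<alpha> (X \<omega> - s))"
  proof (rule integral_mono)
    fix \<omega>
    show "expectile_score \<alpha> (X \<omega> - t) + min \<alpha> (1 - \<alpha>) * (t - s) \<le> expectile_score \<alpha> (X \<omega> - s)"
      using expectile_score_increment[OF assms(2,3), of "X \<omega> - t" "X \<omega> - s"] assms(4) by simp
  qed (use int in auto)
  finally show ?thesis .
qed

text \<open>The expected score is continuous in \<open>t\<close> and decreases at rate at least
  \<open>min \<alpha> (1 - \<alpha>)\<close>, so it changes sign on an interval around 0 whose length is governed by its
  value at 0.\<close>

lemma ex_zero_expectation_score:
  assumes "integrable M X" "0 < \<alpha>" "\<alpha> < 1"
  shows "\<exists>t. expectation (\<lambda>\<omega>. expectile_score \<alpha> (X \<omega> - t)) = 0"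
proof -
  define G where "G t = expectation (\<lambda>\<omega>. expectile_score \<alpha> (X \<omega> - t))" for t
  define c where "c = min \<alpha> (1 - \<alpha>)"
  define r where "r = \<bar>G 0\<bar> / c"
  have c: "0 < c" using assms by (simp add: c_def)
  have r: "r \<ge> 0" "c * r = \<bar>G 0\<bar>" using c by (auto simp: r_def)
  have dec: "G t + c * (t - s) \<le> G s" if "s \<le> t" for s t
    using expectation_score_decrease[OF assms that] by (simp add: G_def c_def)
  have sl: "dist (stop_loss M X s) (stop_loss M X t) \<le> 1 * dist s t" for s t
    using stop_loss_Lipschitz[OF assms(1), of s t] stop_loss_Lipschitz[OF assms(1), of t s]
      stop_loss_antimono[OF assms(1), of s t] stop_loss_antimono[OF assms(1), of t s]
    by (cases "s \<le> t") (auto simp: dist_real_def)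
  have "1-lipschitz_on UNIV (stop_loss M X)"
    using sl by (intro lipschitz_onI) auto
  then have "continuous_on UNIV (stop_loss M X)" by (rule lipschitz_on_continuous_on)
  then have "continuous_on UNIV G"
    unfolding G_def expectation_score(2)[OF assms(1)] by (intro continuous_intros)
  then have "\<exists>t\<ge>-r. t \<le> r \<and> G t = 0"
    using dec[of 0 r] dec[of "-r" 0] r
    by (intro IVT2') (auto intro: continuous_on_subset)
  then show ?thesis unfolding G_def by blast
qed

lemma expectile_eqI:
  assumes "integrable M X" "0 < \<alpha>" "\<alpha> < 1"
    and zero: "expectation (\<lambda>\<omega>. expectile_score \<alpha> (X \<omega> - t)) = 0"
  shows "expectile M X \<alpha> = t"
proof -
  have gap: "expectile_risk M X \<alpha> t + min \<alpha> (1 - \<alpha>) * (t - s)\<^sup>2 \<le> expectile_risk M X \<alpha> s" for s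
    using expectile_risk_above_parabola[OF assms(1-3), of t s] zero by simp
  have less: "expectile_risk M X \<alpha> t < expectile_risk M X \<alpha> s" if "s \<noteq> t" for s
  proof -
    have "0 < min \<alpha> (1 - \<alpha>) * (t - s)\<^sup>2" using assms that by simp
    then show ?thesis using gap[of s] by linarith
  qed
  show ?thesis unfolding expectile_def
  proof (rule the_equality)
    show "is_arg_min (expectile_risk M X \<alpha>) (\<lambda>_. True) t"
      unfolding is_arg_min_def using less by (metis less_irrefl less_asym)
    show "s = t" if "is_arg_min (expectile_risk M X \<alpha>) (\<lambda>_. True) s" for s
      using that less unfolding is_arg_min_def by metis
  qed
qed

text \<open>Since the expected score is strictly decreasing with its zero at the expectile, its sign at
  \<open>t\<close> locates \<open>t\<close> relative to the expectile. All further information about expectiles comes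
  from these two equivalences.\<close>

lemma expectile_compare:
  assumes "integrable M X" "0 < \<alpha>" "\<alpha> < 1"
  shows "t \<le> expectile M X \<alpha> \<longleftrightarrow>
           (1 - \<alpha>) * (t - expectation X) \<le> (2 * \<alpha> - 1) * stop_loss M X t"
    and "expectile M X \<alpha> \<le> t \<longleftrightarrow>
           (2 * \<alpha> - 1) * stop_loss M X t \<le> (1 - \<alpha>) * (t - expectation X)"
proof -
  define G where "G t = expectation (\<lambda>\<omega>. expectile_score \<alpha> (X \<omega> - t))" for t
  define c where "c = min \<alpha> (1 - \<alpha>)"
  have c: "0 < c" using assms by (simp add: c_def)
  have G: "G t = (2 * \<alpha> - 1) * stop_loss M X t - (1 - \<alpha>) * (t - expectation X)" for t
    unfolding G_def expectation_score(2)[OF assms(1)] by (simp add: algebra_simps)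
  have dec: "G t < G s" if "s < t" for s t
    using expectation_score_decrease[OF assms less_imp_le[OF that]] mult_pos_pos[OF c, of "t - s"] that
    unfolding G_def c_def by linarith
  obtain z where z: "G z = 0" using ex_zero_expectation_score[OF assms] unfolding G_def by blast
  then have e: "expectile M X \<alpha> = z" using expectile_eqI[OF assms] unfolding G_def by blast
  have "t \<le> z \<longleftrightarrow> 0 \<le> G t" "z \<le> t \<longleftrightarrow> G t \<le> 0"
    using dec[of z t] dec[of t z] z by (cases t z rule: linorder_cases; auto)+
  then show "t \<le> expectile M X \<alpha> \<longleftrightarrow>
           (1 - \<alpha>) * (t - expectation X) \<le> (2 * \<alpha> - 1) * stop_loss M X t"
    and "expectile M X \<alpha> \<le> t \<longleftrightarrow>
           (2 * \<alpha> - 1) * stop_loss M X t \<le> (1 - \<alpha>) * (t - expectation X)"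
    unfolding e G by auto
qed

lemma expectile_half:
  assumes "integrable M X"
  shows "expectile M X (1/2) = expectation X"
  using expectile_compare[OF assms, of "1/2" "expectation X"] by auto

end

text \<open>Taking \<open>u = 1/2\<close> or \<open>v = 1/2\<close> splits the order into a comparison of the upper and of the
  lower deviations \<open>a\<close>, \<open>b\<close> from the mean; these two add up to the order again.\<close>

lemma weak_expectile_disp_le_iff_stop_loss:
  assumes "prob_space M" "prob_space N" "integrable M X" "integrable N Y"
  shows "weak_expectile_disp_le M X N Y \<longleftrightarrow>
    (\<forall>d. stop_loss M X (integral\<^sup>L M X + d) \<le> stop_loss N Y (integral\<^sup>L N Y + d))"
proof -
  interpret M: prob_space M by fact
  interpret N: prob_space N by fact
  define m where "m = integral\<^sup>L M X"
  define n where "n = integral\<^sup>L N Y"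
  define P where "P d = stop_loss M X (m + d)" for d
  define Q where "Q d = stop_loss N Y (n + d)" for d
  define a where "a v = expectile M X v - m" for v
  define b where "b v = expectile N Y v - n" for v
  have a: "d \<le> a v \<longleftrightarrow> (1 - v) * d \<le> (2 * v - 1) * P d"
          "a v \<le> d \<longleftrightarrow> (2 * v - 1) * P d \<le> (1 - v) * d" if "0 < v" "v < 1" for d v
    using M.expectile_compare[OF assms(3) that, of "m + d"] by (auto simp: a_def P_def m_def)
  have b: "d \<le> b v \<longleftrightarrow> (1 - v) * d \<le> (2 * v - 1) * Q d"
          "b v \<le> d \<longleftrightarrow> (2 * v - 1) * Q d \<le> (1 - v) * d" if "0 < v" "v < 1" for d v
    using N.expectile_compare[OF assms(4) that, of "n + d"] by (auto simp: b_def Q_def n_def)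
  have half: "a (1/2) = 0" "b (1/2) = 0"
    by (simp_all add: a_def b_def m_def n_def M.expectile_half[OF assms(3)] N.expectile_half[OF assms(4)])
  have disp: "weak_expectile_disp_le M X N Y \<longleftrightarrow>
      (\<forall>u v. 0 < u \<and> u \<le> 1/2 \<and> 1/2 \<le> v \<and> v < 1 \<longrightarrow> a v - a u \<le> b v - b u)"
    unfolding weak_expectile_disp_le_def a_def b_def by simp
  have "weak_expectile_disp_le M X N Y \<longleftrightarrow> (\<forall>d. P d \<le> Q d)"
  proof
    assume W: "weak_expectile_disp_le M X N Y"
    have up: "a v \<le> b v" if "1/2 \<le> v" "v < 1" for v
      using W[unfolded disp, rule_format, of "1/2" v] that half by simp
    have down: "b u \<le> a u" if "0 < u" "u \<le> 1/2" for u
      using W[unfolded disp, rule_format, of u "1/2"] that half by simp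
    have ne: "P d \<le> Q d" if "d \<noteq> 0" for d
    proof (cases "0 < P d \<and> 0 < P d + d")
      case False
      \<comment> \<open>\<open>P d\<close> then is at most \<open>max 0 (- d)\<close>, which is a lower bound for \<open>Q d\<close>\<close>
      have "P d \<ge> 0" "Q d \<ge> 0" "- d \<le> Q d"
        using M.stop_loss_nonneg N.stop_loss_nonneg N.stop_loss_ge_mean[OF assms(4), of "n + d"]
        unfolding P_def Q_def n_def by auto
      then show ?thesis using False by auto
    next
      case True
      \<comment> \<open>the solution of \<open>(1 - v) * d = (2 * v - 1) * P d\<close>, the level whose expectile deviates by \<open>d\<close>\<close>
      define v where "v = (P d + d) / (2 * P d + d)"
      have pos: "0 < 2 * P d + d" using True by linarith
      have v: "0 < v" "v < 1" using True pos by (auto simp: v_def)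
      have eq: "1 - v = P d / (2 * P d + d)" "2 * v - 1 = d / (2 * P d + d)"
        using pos by (auto simp: v_def field_simps)
      have "a v \<le> d" "d \<le> a v" using a[OF v, of d] unfolding eq by (simp_all add: mult.commute)
      then have av: "a v = d" by simp
      show ?thesis
      proof (cases "d > 0")
        case True
        then have "1/2 \<le> v" using eq(2) pos divide_pos_pos[of d "2 * P d + d"] by linarith
        then have "d \<le> b v" using up[of v] v av by simp
        then have "P d * d \<le> d * Q d" using b(1)[OF v, of d] pos unfolding eq by (simp add: divide_simps)
        then show ?thesis using True by simp
      next
        case False
        then have d: "d < 0" using that by simp
        then have "v \<le> 1/2" using eq(2) pos divide_neg_pos[of d "2 * P d + d"] by linarith
        then have "b v \<le> d" using down[of v] v av by simp
        then have "d * Q d \<le> P d * d" using b(2)[OF v, of d] pos unfolding eq by (simp add: divide_simps)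
        then show ?thesis using d by simp
      qed
    qed
    have "P 0 \<le> Q 0"
    proof (rule field_le_epsilon)
      fix e :: real assume e: "0 < e"
      have "P 0 \<le> P e + e"
        using M.stop_loss_Lipschitz[OF assms(3), of m "m + e"] e by (simp add: P_def)
      also have "P e \<le> Q e" using ne e by simp
      also have "Q e \<le> Q 0"
        using N.stop_loss_antimono[OF assms(4), of n "n + e"] e by (simp add: Q_def)
      finally show "P 0 \<le> Q 0 + e" by simp
    qed
    then show "\<forall>d. P d \<le> Q d" using ne by metis
  next
    assume le: "\<forall>d. P d \<le> Q d"
    have up: "a v \<le> b v" if v: "1/2 \<le> v" "v < 1" for v
    proof -
      have v0: "0 < v" using v by simp
      have "(1 - v) * a v \<le> (2 * v - 1) * P (a v)" using a(1)[OF v0 v(2)] by blast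
      also have "\<dots> \<le> (2 * v - 1) * Q (a v)" using v le by (intro mult_left_mono) auto
      finally show ?thesis using b(1)[OF v0 v(2)] by blast
    qed
    have down: "b u \<le> a u" if u: "0 < u" "u \<le> 1/2" for u
    proof -
      have u1: "u < 1" using u by simp
      have "(1 - u) * b u \<le> (2 * u - 1) * Q (b u)" using b(1)[OF u(1) u1] by blast
      also have "\<dots> \<le> (2 * u - 1) * P (b u)" using u le by (intro mult_left_mono_neg) auto
      finally show ?thesis using a(1)[OF u(1) u1] by blast
    qed
    show "weak_expectile_disp_le M X N Y" unfolding disp using up down by (meson diff_mono)
  qed
  then show ?thesis by (simp add: P_def Q_def m_def n_def)
qed

section \<open>The convex order through the stop-loss transform\<close>

lemma convex_on_UNIV_subgradient:
  fixes \<phi> :: "real \<Rightarrow> real"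
  assumes "convex_on UNIV \<phi>"
  obtains g where "\<And>t x. \<phi> t + g t * (x - t) \<le> \<phi> x" "mono g"
proof -
  define g where "g x = Inf ((\<lambda>t. (\<phi> x - \<phi> t) / (x - t)) ` ({x<..} \<inter> UNIV))" for x
  have sub: "\<phi> t + g t * (x - t) \<le> \<phi> x" for t x
    unfolding g_def by (rule convex_le_Inf_differential[OF assms]) auto
  have "mono g"
  proof (rule monoI)
    fix s t :: real assume "s \<le> t"
    have "(g s - g t) * (t - s) \<le> 0"
      using sub[of s t] sub[of t s] by (simp add: algebra_simps)
    then show "g s \<le> g t" using \<open>s \<le> t\<close>
      by (cases "s = t") (auto simp: mult_le_0_iff)
  qed
  then show ?thesis using sub that by blast
qed

text \<open>To the right of \<open>Max A\<close> the largest tangent over \<open>A\<close> is the last one. The new tangent, at least as steep,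
  overtakes that one only to the right of \<open>Max A\<close>, so it suffices to compare it with the last
  tangent alone, and its excess is the positive part of a nondecreasing affine function.\<close>

lemma Max_tangents_insert:
  fixes \<phi> g :: "real \<Rightarrow> real"
  assumes sub: "\<And>t x. \<phi> t + g t * (x - t) \<le> \<phi> x" and "mono g"
    and A: "finite A" "A \<noteq> {}" and b: "\<And>a. a \<in> A \<Longrightarrow> a < b"
  defines "l \<equiv> \<lambda>t x. \<phi> t + g t * (x - t)"
  shows "Max ((\<lambda>t. l t x) ` insert b A)
           = Max ((\<lambda>t. l t x) ` A) + max 0 (l b x - l (Max A) x)"
proof -
  define p where "p = Max A"
  have p: "p \<in> A" "p < b" using A b by (auto simp: p_def)
  have le: "l t x \<le> l s x" if "t \<le> s" "s \<le> x" for s t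
  proof -
    have "l t x = l t s + g t * (x - s)" by (simp add: l_def algebra_simps)
    also have "\<dots> \<le> \<phi> s + g s * (x - s)"
      using sub[of t s] that monoD[OF \<open>mono g\<close>, of t s] unfolding l_def
      by (intro add_mono mult_right_mono) auto
    finally show ?thesis by (simp add: l_def)
  qed
  have "Max ((\<lambda>t. l t x) ` insert b A) = max (l b x) (Max ((\<lambda>t. l t x) ` A))"
    using A by simp
  also have "\<dots> = Max ((\<lambda>t. l t x) ` A) + max 0 (l b x - l p x)"
  proof (cases "p \<le> x")
    case True
    have "Max ((\<lambda>t. l t x) ` A) = l p x"
      using A p(1) le[OF _ True] by (intro Max_eqI) (auto simp: p_def)
    then show ?thesis by simp
  next
    case False
    have "l b x = l b p + g b * (x - p)" by (simp add: l_def algebra_simps)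
    also have "\<dots> \<le> \<phi> p + g p * (x - p)"
      using sub[of b p] False p monoD[OF \<open>mono g\<close>, of p b] unfolding l_def
      by (intro add_mono mult_right_mono_neg) auto
    finally have "l b x \<le> l p x" by (simp add: l_def)
    moreover have "l p x \<le> Max ((\<lambda>t. l t x) ` A)" using A p by (intro Max_ge) auto
    ultimately show ?thesis by simp
  qed
  finally show ?thesis by (simp add: p_def)
qed

text \<open>Tangents at rational points suffice to recover \<open>\<phi>\<close>. The rational point is sought to the
  right of \<open>x\<close>, within distance 1, where the slopes are bounded above by \<open>g (x + 1)\<close>.\<close>

lemma rational_tangent_close:
  fixes \<phi> g :: "real \<Rightarrow> real"
  assumes conv: "convex_on UNIV \<phi>"
    and sub: "\<And>t x. \<phi> t + g t * (x - t) \<le> \<phi> x" and "mono g" and "0 < e"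
  obtains t where "t \<in> \<rat>" "\<phi> x - e < \<phi> t + g t * (x - t)"
proof -
  have "continuous_on UNIV \<phi>" using conv by (intro convex_on_continuous) auto
  then have "isCont \<phi> x" by (simp add: continuous_on_eq_continuous_at)
  then have "((\<lambda>t. \<phi> t + g (x + 1) * (x - t)) \<longlongrightarrow> \<phi> x + g (x + 1) * (x - x)) (at_right x)"
    by (intro tendsto_intros) (auto simp: isCont_def filterlim_at_split)
  then have "eventually (\<lambda>t. \<phi> x - e < \<phi> t + g (x + 1) * (x - t)) (at_right x)"
    using \<open>0 < e\<close> by (intro order_tendstoD(1)) auto
  then obtain b where b: "x < b" "\<And>t. x < t \<Longrightarrow> t < b \<Longrightarrow> \<phi> x - e < \<phi> t + g (x + 1) * (x - t)"
    unfolding eventually_at_right_field by blast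
  have "x < min b (x + 1)" using b by simp
  then obtain t where t: "t \<in> \<rat>" "x < t" "t < min b (x + 1)" using Rats_dense_in_real by blast
  have "g (x + 1) * (x - t) \<le> g t * (x - t)"
    using t monoD[OF \<open>mono g\<close>, of t "x + 1"] by (intro mult_right_mono_neg) auto
  then have "\<phi> x - e < \<phi> t + g t * (x - t)" using b(2)[of t] t by linarith
  then show ?thesis using that t by blast
qed

context prob_space
begin

lemma integrable_Max_tangents:
  fixes \<phi> g :: "real \<Rightarrow> real"
  assumes "integrable M X" "finite A" "A \<noteq> {}"
  shows "integrable M (\<lambda>\<omega>. Max ((\<lambda>t. \<phi> t + g t * (X \<omega> - t)) ` A))"
  using assms(2,3)
proof (induction A rule: finite_ne_induct)
  case (singleton t)
  then show ?case using assms(1) by simp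
next
  case (insert t A)
  then show ?case using assms(1) by simp
qed

lemma expectation_pos_affine:
  assumes "integrable M X" "0 \<le> c"
  shows "expectation (\<lambda>\<omega>. max 0 (a + c * X \<omega>))
    = (if c = 0 then max 0 a else c * stop_loss M X (- a / c))"
proof (cases "c = 0")
  case False
  then have "c * (x - - a / c) = a + c * x" for x by (simp add: field_simps)
  then have "max 0 (a + c * x) = c * max 0 (x - - a / c)" for x
    using assms(2) by (simp only: max_mult_distrib_left if_True mult_zero_right)
  then show ?thesis using False by (simp add: stop_loss_def)
qed (simp add: prob_space)

text \<open>The maxima lie between the first tangent and \<open>\<phi>\<close> itself, both of which are integrable
  along \<open>X\<close>, so dominated convergence applies.\<close>

lemma Max_tangents_tendsto_expectation:
  fixes \<phi> g :: "real \<Rightarrow> real"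
  assumes X: "integrable M X" and conv: "convex_on UNIV \<phi>"
    and int: "integrable M (\<lambda>\<omega>. \<phi> (X \<omega>))"
    and sub: "\<And>t x. \<phi> t + g t * (x - t) \<le> \<phi> x" and "mono g"
    and r: "range r = \<rat>"
  shows "(\<lambda>n. expectation (\<lambda>\<omega>. Max ((\<lambda>t. \<phi> t + g t * (X \<omega> - t)) ` r ` {..n})))
           \<longlonglongrightarrow> expectation (\<lambda>\<omega>. \<phi> (X \<omega>))"
proof -
  define l where "l t x = \<phi> t + g t * (x - t)" for t x
  define F where "F n x = Max ((\<lambda>t. l t x) ` r ` {..n::nat})" for n x
  have ge: "l (r k) x \<le> F n x" if "k \<le> n" for k n x
    unfolding F_def using that by (intro Max_ge) auto
  have le: "F n x \<le> \<phi> x" for n x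
    unfolding F_def using sub by (intro Max.boundedI) (auto simp: l_def)
  have intF: "integrable M (\<lambda>\<omega>. F n (X \<omega>))" for n
    unfolding F_def l_def by (intro integrable_Max_tangents X) auto
  have lim: "(\<lambda>n. F n x) \<longlonglongrightarrow> \<phi> x" for x
  proof (rule LIMSEQ_I)
    fix e :: real assume "0 < e"
    then obtain t where t: "t \<in> \<rat>" "\<phi> x - e < l t x"
      using rational_tangent_close[OF conv sub \<open>mono g\<close>] unfolding l_def by metis
    then obtain k where "t = r k" using r by blast
    then have "norm (F n x - \<phi> x) < e" if "k \<le> n" for n
      using ge[OF that, of x] le[of n x] t by simp
    then show "\<exists>k. \<forall>n\<ge>k. norm (F n x - \<phi> x) < e" by blast
  qed
  have "(\<lambda>n. expectation (\<lambda>\<omega>. F n (X \<omega>))) \<longlonglongrightarrow> expectation (\<lambda>\<omega>. \<phi> (X \<omega>))"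
  proof (rule integral_dominated_convergence)
    show "integrable M (\<lambda>\<omega>. \<bar>\<phi> (X \<omega>)\<bar> + \<bar>l (r 0) (X \<omega>)\<bar>)"
      using X int unfolding l_def by simp
    show "AE \<omega> in M. norm (F n (X \<omega>)) \<le> \<bar>\<phi> (X \<omega>)\<bar> + \<bar>l (r 0) (X \<omega>)\<bar>" for n
    proof (rule AE_I2)
      fix \<omega>
      show "norm (F n (X \<omega>)) \<le> \<bar>\<phi> (X \<omega>)\<bar> + \<bar>l (r 0) (X \<omega>)\<bar>"
        using ge[of 0 n "X \<omega>"] le[of n "X \<omega>"] by simp
    qed
  qed (use int intF lim in auto)
  then show ?thesis unfolding F_def l_def .
qed

end

text \<open>Equality of the means handles the first tangent, which is affine, and the tangents added
  later with no increase in slope contribute constants; all other contributions are multiples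
  of stop-loss functions.\<close>

lemma convex_order_le_iff_stop_loss:
  assumes "prob_space M" "prob_space N" and X: "integrable M X" and Y: "integrable N Y"
    and mean: "integral\<^sup>L M X = integral\<^sup>L N Y"
  shows "convex_order_le M X N Y \<longleftrightarrow> (\<forall>t. stop_loss M X t \<le> stop_loss N Y t)"
proof
  interpret M: prob_space M by fact
  interpret N: prob_space N by fact
  assume cx: "convex_order_le M X N Y"
  show "\<forall>t. stop_loss M X t \<le> stop_loss N Y t"
  proof
    fix t :: real
    have "convex_on UNIV (\<lambda>x. max 0 (x - t))"
    proof (rule convex_onI)
      fix s x y :: real assume "0 < s" "s < 1"
      then have "(1 - s) * (x - t) \<le> (1 - s) * max 0 (x - t)" "s * (y - t) \<le> s * max 0 (y - t)"
        "0 \<le> (1 - s) * max 0 (x - t)" "0 \<le> s * max 0 (y - t)"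
        by (auto intro!: mult_left_mono)
      moreover have "(1 - s) *\<^sub>R x + s *\<^sub>R y - t = (1 - s) * (x - t) + s * (y - t)"
        by (simp add: algebra_simps)
      ultimately show "max 0 ((1 - s) *\<^sub>R x + s *\<^sub>R y - t)
          \<le> (1 - s) * max 0 (x - t) + s * max 0 (y - t)"
        by linarith
    qed auto
    then show "stop_loss M X t \<le> stop_loss N Y t"
      using cx M.integrable_stop_loss[OF X] N.integrable_stop_loss[OF Y]
      unfolding convex_order_le_def stop_loss_def by blast
  qed
next
  interpret M: prob_space M by fact
  interpret N: prob_space N by fact
  assume sl: "\<forall>t. stop_loss M X t \<le> stop_loss N Y t"
  show "convex_order_le M X N Y"
    unfolding convex_order_le_def
  proof (intro allI impI)
    fix \<phi> :: "real \<Rightarrow> real"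
    assume conv: "convex_on UNIV \<phi>"
      and int: "integrable M (\<lambda>\<omega>. \<phi> (X \<omega>))" "integrable N (\<lambda>\<omega>. \<phi> (Y \<omega>))"
    obtain g where sub: "\<And>t x. \<phi> t + g t * (x - t) \<le> \<phi> x" and "mono g"
      using convex_on_UNIV_subgradient[OF conv] by blast
    define l where "l t x = \<phi> t + g t * (x - t)" for t x
    define F where "F A x = Max ((\<lambda>t. l t x) ` A)" for A x
    have intX: "integrable M (\<lambda>\<omega>. F A (X \<omega>))" and intY: "integrable N (\<lambda>\<omega>. F A (Y \<omega>))"
      if "finite A" "A \<noteq> {}" for A
      unfolding F_def l_def using that
      by (auto intro: M.integrable_Max_tangents X N.integrable_Max_tangents Y)
    have fin: "(\<integral>\<omega>. F A (X \<omega>) \<partial>M) \<le> (\<integral>\<omega>. F A (Y \<omega>) \<partial>N)" if "finite A" "A \<noteq> {}" for A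
      using that
    proof (induction A rule: finite_linorder_max_induct)
      case (insert b A)
      show ?case
      proof (cases "A = {}")
        case True
        then show ?thesis using X Y mean
          by (simp add: F_def l_def M.prob_space N.prob_space)
      next
        case False
        define c where "c = g b - g (Max A)"
        define k where "k = l b 0 - l (Max A) 0"
        have "c \<ge> 0"
          using insert False monoD[OF \<open>mono g\<close>, of "Max A" b] by (simp add: c_def less_imp_le)
        have step: "F (insert b A) x = F A x + max 0 (k + c * x)" for x
          using Max_tangents_insert[OF sub \<open>mono g\<close> insert(1) False, of b x] insert(2)
          unfolding F_def l_def k_def c_def by (simp add: algebra_simps)
        have "(\<integral>\<omega>. max 0 (k + c * X \<omega>) \<partial>M) \<le> (\<integral>\<omega>. max 0 (k + c * Y \<omega>) \<partial>N)"
          unfolding M.expectation_pos_affine[OF X \<open>c \<ge> 0\<close>] N.expectation_pos_affine[OF Y \<open>c \<ge> 0\<close>]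
          using sl \<open>c \<ge> 0\<close> by (simp add: mult_left_mono)
        moreover have "integrable M (\<lambda>\<omega>. max 0 (k + c * X \<omega>))"
          "integrable N (\<lambda>\<omega>. max 0 (k + c * Y \<omega>))"
          using X Y by auto
        ultimately show ?thesis
          unfolding step using insert False intX[of A] intY[of A] by simp
      qed
    qed simp
    define r where "r = from_nat_into (\<rat> :: real set)"
    have r: "range r = \<rat>"
      unfolding r_def by (rule range_from_nat_into) (auto simp: countable_rat intro: Rats_0)
    show "(\<integral>\<omega>. \<phi> (X \<omega>) \<partial>M) \<le> (\<integral>\<omega>. \<phi> (Y \<omega>) \<partial>N)"
    proof (rule LIMSEQ_le)
      show "(\<lambda>n. \<integral>\<omega>. F (r ` {..n}) (X \<omega>) \<partial>M) \<longlonglongrightarrow> (\<integral>\<omega>. \<phi> (X \<omega>) \<partial>M)"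
        unfolding F_def l_def
        by (rule M.Max_tangents_tendsto_expectation[OF X conv int(1) sub \<open>mono g\<close> r])
      show "(\<lambda>n. \<integral>\<omega>. F (r ` {..n}) (Y \<omega>) \<partial>N) \<longlonglongrightarrow> (\<integral>\<omega>. \<phi> (Y \<omega>) \<partial>N)"
        unfolding F_def l_def
        by (rule N.Max_tangents_tendsto_expectation[OF Y conv int(2) sub \<open>mono g\<close> r])
      show "\<exists>n. \<forall>i\<ge>n. (\<integral>\<omega>. F (r ` {..i}) (X \<omega>) \<partial>M) \<le> (\<integral>\<omega>. F (r ` {..i}) (Y \<omega>) \<partial>N)"
        using fin by auto
    qed
  qed
qed

section \<open>The weak expectile dispersive order is the dilation order\<close>

theorem theorem9:
  fixes M :: "'a measure" and N :: "'b measure"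
    and X :: "'a \<Rightarrow> real" and Y :: "'b \<Rightarrow> real"
  assumes "prob_space M" and "prob_space N"
    and "integrable M X" and "integrable N Y"
    and "\<not> degenerate M X" and "\<not> degenerate N Y"
    and "atomless (distr M borel X)" and "atomless (distr N borel Y)"
    and "is_interval (measure_support (distr M borel X))"
    and "is_interval (measure_support (distr N borel Y))"
  shows "weak_expectile_disp_le M X N Y \<longleftrightarrow> dilation_le M X N Y"
proof -
  interpret M: prob_space M by fact
  interpret N: prob_space N by fact
  have "dilation_le M X N Y \<longleftrightarrow>
      (\<forall>t. stop_loss M (\<lambda>\<omega>. X \<omega> - integral\<^sup>L M X) t \<le> stop_loss N (\<lambda>\<omega>. Y \<omega> - integral\<^sup>L N Y) t)"
    unfolding dilation_le_def using assms(1-4)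
    by (intro convex_order_le_iff_stop_loss) (simp_all add: M.prob_space N.prob_space)
  also have "\<dots> \<longleftrightarrow> weak_expectile_disp_le M X N Y"
    unfolding weak_expectile_disp_le_iff_stop_loss[OF assms(1-4)]
    by (simp add: stop_loss_def algebra_simps)
  finally show ?thesis by simp
qed

end
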